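(* Consider a Poisson bracket of the form $$\{u(x^1,x^2),u(y^1,y^2)\}=\delta(x^1-y^1)\,\delta^{(1)}(x^2-y^2)+\sum_{k>0}\epsilon^k\sum_{\substack{k_1,k_2\ge0\\ k_1+k_2\le k+1}}A_{k;k_1,k_2}(u(x))\,\delta^{(k_1)}(x^1-y^1)\,\delta^{(k_2)}(x^2-y^2),$$ where $A_{k;k_1,k_2}\in\mathcal{A}$ is homogeneous with $\deg A_{k;k_1,k_2}=k-k_1-k_2+1$ (so that $A_{k;k_1,k_2}$ is a function of $u$ only when $k_1+k_2=k+1$). Let $c_1,c_2,\dots$ be its numerical invariants, i.e. the constants such that the bracket is mapped by a Miura transformation of the second kind to $$\delta(x^1-y^1)\,\delta^{(1)}(x^2-y^2)+\sum_{k\ge1}\epsilon^{2k}c_k\,\delta^{(2k+1)}(x^1-y^1)\,\delta(x^2-y^2).$$ Then $A_{2;3,0}$ is a constant and $$c_1=A_{2;3,0},\qquad c_2=A_{4;5,0}(u)-A_{2;3,0}\,A_{2;2,1}(u).$$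
   Context: Let $U\subseteq\mathbb{R}$ be an open interval. $\mathcal{A}=C^\infty(U)[[\{u^{(k_1,k_2)}: k_1,k_2\ge0,\ (k_1,k_2)\ne(0,0)\}]]$ is the algebra of differential polynomials: formal power series in the variables $u^{(k_1,k_2)}=\partial_{x^1}^{k_1}\partial_{x^2}^{k_2}u$ with coefficients smooth functions of $u=u^{(0,0)}\in U$, with the total derivatives $\partial_{x^1},\partial_{x^2}$. The grading is $\deg u^{(k_1,k_2)}=k_1+k_2$, smooth functions of $u$ having degree $0$; $\mathcal{A}_d$ is the degree $d$ component. Local functionals are elements of $\mathcal{F}=\mathcal{A}/(\partial_{x^1}\mathcal{A}+\partial_{x^2}\mathcal{A})$, the class of $f$ being written $\int f$; the variational derivative is $\frac{\delta}{\delta u}\int f=\sum_{s,t}(-\partial_{x^1})^s(-\partial_{x^2})^t\frac{\partial f}{\partial u^{(s,t)}}$. Everything is extended to formal power series in $\epsilon$. An expression $\{u(x),u(y)\}=\sum_k\epsilon^k\sum_{k_1,k_2}A_{k;k_1,k_2}(u(x))\delta^{(k_1)}(x^1-y^1)\delta^{(k_2)}(x^2-y^2)$ is identified with the differential operator $P=\sum_k\epsilon^k\sum_{k_1,k_2}A_{k;k_1,k_2}\,\partial_{x^1}^{k_1}\partial_{x^2}^{k_2}$ and defines the bracket $\{I_1,I_2\}=\int\frac{\delta I_1}{\delta u}P\big(\frac{\delta I_2}{\delta u}\big)$ on local functionals. It is a Poisson bracket if this bracket is skew-symmetric and satisfies the Jacobi identity. A Miura transformation of the second kind is a change of variable $v=u+\sum_{k\ge1}\epsilon^kF_k$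 with $F_k\in\mathcal{A}_k$. It maps the bracket with operator $P$ to the bracket with operator $L\circ P\circ L^\dagger$ re-expressed in terms of $v$ and its derivatives, where $L=\sum_{s,t}\frac{\partial v}{\partial u^{(s,t)}}\partial_{x^1}^s\partial_{x^2}^t$ and $L^\dagger$ is its formal adjoint. It is a known result (the normal form theorem) that every Poisson bracket of the form in the claim can be mapped by a Miura transformation of the second kind to a bracket of the displayed normal form, and that the sequence of real constants $(c_1,c_2,\dots)$ is uniquely determined by the bracket; these constants are called the numerical invariants of the bracket. *)

theory Defs
  imports
    "HOL-Analysis.Analysis"
    "HOL-Computational_Algebra.Formal_Power_Series"
    "HOL-Library.Multiset"
    "HOL-Library.Groups_Big_Fun"
begin

unbundle no vec_syntax
unbundle fps_syntax

section \<open>Differential polynomials\<close>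

text \<open>
  A monomial in the jet variables \<open>u\<^sup>(\<^sup>s\<^sup>,\<^sup>t\<^sup>)\<close> is a multiset of index pairs \<open>(s, t)\<close>, and a formal
  power series in them is the family of its coefficients, which are functions of \<open>u\<close>.
  The pair \<open>(0, 0)\<close> is not a formal variable and smoothness is only required on the interval \<open>U\<close>;
  both restrictions are imposed by the carrier \<open>diffpoly_alg U\<close> below.
  Values of coefficients outside \<open>U\<close> are irrelevant, and elements are compared by \<open>dp_eq U\<close>.
\<close>

typedef dpoly = "UNIV :: ((nat \<times> nat) multiset \<Rightarrow> real \<Rightarrow> real) set"
  morphisms dcoeff DPoly ..

lemma dcoeff_DPoly [simp]: "dcoeff (DPoly f) = f"
  by (simp add: DPoly_inverse)

lemma dpoly_eqI: "(\<And>M x. dcoeff f M x = dcoeff g M x) \<Longrightarrow> f = g"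
  by (metis dcoeff_inject ext)

lemma finite_mset_splittings: "finite {(N, K). N + K = (M :: 'a multiset)}"
proof -
  have "finite {N. N \<subseteq># M}"
  proof (induction M)
    case (add a M)
    have "N \<in> {N. N \<subseteq># M} \<union> add_mset a ` {N. N \<subseteq># M}" if "N \<subseteq># add_mset a M" for N
    proof (cases "a \<in># N")
      case True
      then obtain K where "N = add_mset a K"
        by (meson mset_add)
      with that show ?thesis by auto
    next
      case False
      with that show ?thesis
        by (metis UnI1 mem_Collect_eq diff_single_trivial subset_eq_diff_conv add_mset_add_single)
    qed
    hence "{N. N \<subseteq># add_mset a M} \<subseteq> {N. N \<subseteq># M} \<union> add_mset a ` {N. N \<subseteq># M}"
      by blast
    moreover have "finite ({N. N \<subseteq># M} \<union> add_mset a ` {N. N \<subseteq># M})"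
      using add by simp
    ultimately show ?case
      by (rule finite_subset)
  qed simp
  have "{(N, K). N + K = M} \<subseteq> {N. N \<subseteq># M} \<times> {N. N \<subseteq># M}"
    by auto
  thus ?thesis
    using \<open>finite {N. N \<subseteq># M}\<close> finite_subset by blast
qed

instantiation dpoly :: comm_ring_1
begin

definition "0 = DPoly (\<lambda>M x. 0)"
definition "1 = DPoly (\<lambda>M x. if M = {#} then 1 else 0)"
definition "f + g = DPoly (\<lambda>M x. dcoeff f M x + dcoeff g M x)"
definition "- f = DPoly (\<lambda>M x. - dcoeff f M x)"
definition "f - g = DPoly (\<lambda>M x. dcoeff f M x - dcoeff g M x)"
definition "f * g = DPoly (\<lambda>M x. \<Sum>(N, K) | N + K = M. dcoeff f N x * dcoeff g K x)"

lemma dcoeff_0 [simp]: "dcoeff 0 M x = 0"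
  and dcoeff_1: "dcoeff 1 M x = (if M = {#} then 1 else 0)"
  and dcoeff_add [simp]: "dcoeff (f + g) M x = dcoeff f M x + dcoeff g M x"
  and dcoeff_minus [simp]: "dcoeff (- f) M x = - dcoeff f M x"
  and dcoeff_diff [simp]: "dcoeff (f - g) M x = dcoeff f M x - dcoeff g M x"
  and dcoeff_mult: "dcoeff (f * g) M x = (\<Sum>(N, K) | N + K = M. dcoeff f N x * dcoeff g K x)"
  by (simp_all add: zero_dpoly_def one_dpoly_def plus_dpoly_def uminus_dpoly_def
      minus_dpoly_def times_dpoly_def)

instance
proof
  fix f g h :: dpoly
  show "f * g * h = f * (g * h)"
  proof (rule dpoly_eqI)
    fix M x
    let ?t = "\<lambda>A B C. dcoeff f A x * dcoeff g B x * dcoeff h C x"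
    have "dcoeff (f * g * h) M x =
        (\<Sum>p | fst p + snd p = M. \<Sum>q | fst q + snd q = fst p. ?t (fst q) (snd q) (snd p))"
      by (simp add: dcoeff_mult sum_distrib_right case_prod_unfold)
    also have "\<dots> = (\<Sum>(p, q) \<in> (SIGMA p:{p. fst p + snd p = M}. {q. fst q + snd q = fst p}).
        ?t (fst q) (snd q) (snd p))"
      using finite_mset_splittings by (subst sum.Sigma) (auto simp: case_prod_unfold)
    also have "\<dots> = (\<Sum>(p, q) \<in> (SIGMA p:{p. fst p + snd p = M}. {q. fst q + snd q = snd p}).
        ?t (fst p) (fst q) (snd q))"
      by (rule sum.reindex_bij_witness
          [where i = "\<lambda>(p, q). ((fst p + fst q, snd q), (fst p, fst q))"
             and j = "\<lambda>(p, q). ((fst q, snd q + snd p), (snd q, snd p))"])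
         (auto simp: add.assoc)
    also have "\<dots> = (\<Sum>p | fst p + snd p = M. \<Sum>q | fst q + snd q = snd p.
        ?t (fst p) (fst q) (snd q))"
      using finite_mset_splittings by (subst sum.Sigma) (auto simp: case_prod_unfold)
    also have "\<dots> = dcoeff (f * (g * h)) M x"
      by (simp add: dcoeff_mult sum_distrib_left case_prod_unfold mult.assoc)
    finally show "dcoeff (f * g * h) M x = dcoeff (f * (g * h)) M x" .
  qed
  show "f * g = g * f"
  proof (rule dpoly_eqI)
    fix M x
    show "dcoeff (f * g) M x = dcoeff (g * f) M x"
      unfolding dcoeff_mult
      by (rule sum.reindex_bij_witness[where i = prod.swap and j = prod.swap])
         (auto simp: add.commute)
  qed
  show "1 * f = f"
  proof (rule dpoly_eqI)
    fix M x
    have "dcoeff (1 * f) M x = (\<Sum>(N, K) \<in> {({#}, M)}. dcoeff 1 N x * dcoeff f K x)"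
      unfolding dcoeff_mult using finite_mset_splittings
      by (intro sum.mono_neutral_right) (auto simp: dcoeff_1 split: if_splits)
    thus "dcoeff (1 * f) M x = dcoeff f M x"
      by (simp add: dcoeff_1)
  qed
  show "(f + g) * h = f * h + g * h"
    by (rule dpoly_eqI) (simp add: dcoeff_mult case_prod_unfold distrib_right sum.distrib)
  show "(0::dpoly) \<noteq> 1"
    by (metis dcoeff_0 dcoeff_1 zero_neq_one)
qed (auto intro!: dpoly_eqI)

end

definition smooth_fun_on :: "real set \<Rightarrow> (real \<Rightarrow> real) \<Rightarrow> bool" where
  "smooth_fun_on U f \<longleftrightarrow> (\<forall>n. (deriv ^^ n) f differentiable_on U)"

definition mdegree :: "(nat \<times> nat) multiset \<Rightarrow> nat" where
  "mdegree M = (\<Sum>(s, t) \<in># M. s + t)"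

definition diffpoly_alg :: "real set \<Rightarrow> dpoly set" where
  "diffpoly_alg U = {f. \<forall>M. smooth_fun_on U (dcoeff f M) \<and>
     ((0, 0) \<in># M \<longrightarrow> (\<forall>x\<in>U. dcoeff f M x = 0))}"

definition diffpoly_homog :: "real set \<Rightarrow> nat \<Rightarrow> dpoly set" where
  "diffpoly_homog U d =
     {f \<in> diffpoly_alg U. \<forall>M. mdegree M \<noteq> d \<longrightarrow> (\<forall>x\<in>U. dcoeff f M x = 0)}"

definition dp_eq :: "real set \<Rightarrow> dpoly \<Rightarrow> dpoly \<Rightarrow> bool" where
  "dp_eq U f g \<longleftrightarrow> (\<forall>M. \<forall>x\<in>U. dcoeff f M x = dcoeff g M x)"

definition dp_fun :: "(real \<Rightarrow> real) \<Rightarrow> dpoly" where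
  "dp_fun \<phi> = DPoly (\<lambda>M x. if M = {#} then \<phi> x else 0)"

definition dp_const :: "real \<Rightarrow> dpoly" where
  "dp_const a = dp_fun (\<lambda>_. a)"

definition jet :: "nat \<times> nat \<Rightarrow> dpoly" where
  "jet k = (if k = (0, 0) then dp_fun (\<lambda>x. x) else DPoly (\<lambda>M x. if M = {#k#} then 1 else 0))"


section \<open>Formal power series in \<open>\<epsilon>\<close>\<close>

text \<open>From here on the algebra is extended to power series in \<open>\<epsilon>\<close>; the exponent of \<open>\<epsilon>\<close> is the
  index of the type \<open>fps\<close>.\<close>

type_synonym edpoly = "dpoly fps"

definition eps_alg :: "real set \<Rightarrow> edpoly set" where
  "eps_alg U = {f. \<forall>n. f $ n \<in> diffpoly_alg U}"

definition eps_eq :: "real set \<Rightarrow> edpoly \<Rightarrow> edpoly \<Rightarrow> bool" where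
  "eps_eq U f g \<longleftrightarrow> (\<forall>n. dp_eq U (f $ n) (g $ n))"

text \<open>The sum of an infinite family in which every scalar coefficient receives only finitely many
  nonzero contributions. The families used below are of this kind at every point of \<open>U\<close>.\<close>

definition formal_sum :: "('i \<Rightarrow> edpoly) \<Rightarrow> edpoly" where
  "formal_sum g = Abs_fps (\<lambda>n. DPoly (\<lambda>M x. Sum_any (\<lambda>i. dcoeff (g i $ n) M x)))"

text \<open>For a formal variable, the coefficient of \<open>M\<close> in \<open>\<partial>f/\<partial>u\<^sup>k\<close> comes from the monomial \<open>u\<^sup>k M\<close>,
  in which \<open>u\<^sup>k\<close> has exponent \<open>count M k + 1\<close>.\<close>

definition jet_deriv :: "nat \<times> nat \<Rightarrow> edpoly \<Rightarrow> edpoly" where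
  "jet_deriv k f = Abs_fps (\<lambda>n. DPoly (\<lambda>M.
     if k = (0, 0) then deriv (dcoeff (f $ n) M)
     else (\<lambda>x. real (count M k + 1) * dcoeff (f $ n) (add_mset k M) x)))"

text \<open>The total derivative in the direction \<open>e\<close>, where \<open>e = (1, 0)\<close> stands for \<open>x\<^sup>1\<close> and
  \<open>e = (0, 1)\<close> for \<open>x\<^sup>2\<close>.\<close>

definition total_deriv :: "nat \<times> nat \<Rightarrow> edpoly \<Rightarrow> edpoly" where
  "total_deriv e f = formal_sum (\<lambda>k. fps_const (jet (k + e)) * jet_deriv k f)"

definition Dx :: "nat \<times> nat \<Rightarrow> edpoly \<Rightarrow> edpoly" where
  "Dx k f = (total_deriv (1, 0) ^^ fst k) ((total_deriv (0, 1) ^^ snd k) f)"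

lemma dcoeff_jet_mult:
  assumes "k \<noteq> (0, 0)"
  shows "dcoeff (jet k * g) M x = (if k \<in># M then dcoeff g (M - {#k#}) x else 0)"
proof -
  have "dcoeff (jet k * g) M x =
      (\<Sum>(N, K) \<in> (if k \<in># M then {({#k#}, M - {#k#})} else {}). dcoeff (jet k) N x * dcoeff g K x)"
    unfolding dcoeff_mult using assms finite_mset_splittings
    by (intro sum.mono_neutral_right) (auto simp: jet_def split: if_splits)
  thus ?thesis
    using assms by (simp add: jet_def)
qed

lemma locally_finite_total_deriv:
  assumes "e \<noteq> (0, 0)"
  shows "finite {k. dcoeff ((fps_const (jet (k + e)) * jet_deriv k f) $ n) M x \<noteq> 0}"
proof -
  have ne: "k + e \<noteq> (0, 0)" for k :: "nat \<times> nat"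
    using assms by (cases k; cases e) auto
  have "{k. dcoeff ((fps_const (jet (k + e)) * jet_deriv k f) $ n) M x \<noteq> 0}
      \<subseteq> {k. k + e \<in># M}"
    using ne by (auto simp: dcoeff_jet_mult split: if_splits)
  moreover have "finite ((\<lambda>k. k + e) -` set_mset M)"
    by (rule finite_vimageI) (auto simp: inj_on_def)
  ultimately show ?thesis
    by (auto simp: vimage_def intro: finite_subset)
qed

lemma dcoeff_total_deriv:
  assumes "e \<noteq> (0, 0)"
  shows "dcoeff (total_deriv e f $ n) M x =
    (\<Sum>k | k + e \<in># M. dcoeff (jet_deriv k f $ n) (M - {#k + e#}) x)"
proof -
  have ne: "k + e \<noteq> (0, 0)" for k :: "nat \<times> nat"
    using assms by (cases k; cases e) auto
  have fin: "finite {k. k + e \<in># M}"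
    using finite_vimageI[of "set_mset M" "\<lambda>k. k + e"] by (auto simp: inj_on_def vimage_def)
  have "dcoeff (total_deriv e f $ n) M x =
     (\<Sum>k | k + e \<in># M. dcoeff ((fps_const (jet (k + e)) * jet_deriv k f) $ n) M x)"
    unfolding total_deriv_def formal_sum_def fps_nth_Abs_fps dcoeff_DPoly
    by (rule Sum_any.expand_superset) (use ne fin in \<open>auto simp: dcoeff_jet_mult split: if_splits\<close>)
  also have "\<dots> = (\<Sum>k | k + e \<in># M. dcoeff (jet_deriv k f $ n) (M - {#k + e#}) x)"
    using ne by (intro sum.cong) (auto simp: dcoeff_jet_mult)
  finally show ?thesis .
qed

lemma total_deriv_low:
  assumes e: "e = (1,0) \<or> e = (0,1)" 
    and van: "\<And>M x. mdegree M < d \<Longrightarrow> dcoeff (f $ n) M x = 0"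
    and M: "mdegree M < Suc d"
  shows "dcoeff (total_deriv e f $ n) M x = 0"
proof -
  have ne: "e \<noteq> (0,0)" using e by auto
  have "dcoeff (jet_deriv k f $ n) (M - {#k + e#}) x = 0" if k: "k + e \<in># M" for k
  proof -
    obtain K where K: "M = add_mset (k+e) K" using k by (meson mset_add)
    have deg: "mdegree (add_mset k K) < d"
      using M e K by (cases k) (auto simp: mdegree_def)
    show ?thesis
    proof (cases "k = (0,0)")
      case True
      then have "mdegree K < d" using deg by (simp add: mdegree_def)
      then have "dcoeff (f $ n) K = (\<lambda>_. 0)" using van by auto
      then show ?thesis using True K by (simp add: jet_deriv_def)
    next
      case False
      then show ?thesis using K deg van by (simp add: jet_deriv_def)
    qed
  qed
  then show ?thesis by (simp add: dcoeff_total_deriv[OF ne])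
qed

lemma Dx_low: "mdegree M < fst k + snd k \<Longrightarrow> dcoeff (Dx k f $ n) M x = 0"
proof -
  have 1: "mdegree M < b \<Longrightarrow> dcoeff (((total_deriv (0, 1) ^^ b) f) $ n) M x = 0" for b M x
  proof (induction b arbitrary: M x)
    case (Suc b)
    then show ?case
      using total_deriv_low[of "(0, 1)" b "(total_deriv (0, 1) ^^ b) f" n M x] by simp
  qed simp
  have "mdegree M < a + b \<Longrightarrow>
      dcoeff (((total_deriv (1, 0) ^^ a) ((total_deriv (0, 1) ^^ b) f)) $ n) M x = 0" for a b M x
  proof (induction a arbitrary: M x)
    case (Suc a)
    then show ?case
      using total_deriv_low[of "(1, 0)" "a + b"
          "(total_deriv (1, 0) ^^ a) ((total_deriv (0, 1) ^^ b) f)" n M x] by simp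
  qed (use 1 in simp)
  from this[of M "fst k" "snd k"] show "mdegree M < fst k + snd k \<Longrightarrow> ?thesis" by (simp add: Dx_def)
qed


section \<open>Differential operators, local functionals and Poisson brackets\<close>

text \<open>An operator \<open>\<Sum>\<^sub>k a\<^sub>k \<partial>\<^sup>k\<close> is represented by its coefficient family. Since \<open>\<partial>\<^sup>k\<close> raises the
  differential degree by \<open>\<bar>k\<bar>\<close>, the sums below are well defined for every such family.\<close>

type_synonym diffop = "nat \<times> nat \<Rightarrow> edpoly"

definition op_apply :: "diffop \<Rightarrow> edpoly \<Rightarrow> edpoly" where
  "op_apply P f = formal_sum (\<lambda>k. P k * Dx k f)"

definition adj_apply :: "diffop \<Rightarrow> edpoly \<Rightarrow> edpoly" where
  "adj_apply P f = formal_sum (\<lambda>(s, t). (-1) ^ (s + t) * Dx (s, t) (P (s, t) * f))"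

definition var_deriv :: "edpoly \<Rightarrow> edpoly" where
  "var_deriv f = formal_sum (\<lambda>(s, t). (-1) ^ (s + t) * Dx (s, t) (jet_deriv (s, t) f))"

text \<open>Local finiteness of the sums above; the second lemma covers both \<open>adj_apply\<close> and \<open>var_deriv\<close>.\<close>

lemma locally_finite_op_apply: "finite {k. dcoeff ((P k * Dx k f) $ n) M x \<noteq> 0}"
proof -
  have "dcoeff ((P k * Dx k f) $ n) M x = 0" if "mdegree M < fst k + snd k" for k
  proof -
    have s: "dcoeff (sum g I) M x = (\<Sum>i\<in>I. dcoeff (g i) M x)" for g :: "nat \<Rightarrow> dpoly" and I
      by (induction I rule: infinite_finite_induct) auto
    have "dcoeff (a * (Dx k f $ m)) M x = 0" for a m
      unfolding dcoeff_mult
    proof (intro sum.neutral ballI, clarify)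
      fix N K assume "M = N + K"
      then have "mdegree K \<le> mdegree M" by (simp add: mdegree_def)
      then show "dcoeff a N x * dcoeff (Dx k f $ m) K x = 0" using that Dx_low[of K k f m x] by simp
    qed
    then show ?thesis by (simp add: fps_mult_nth s)
  qed
  then have "{k. dcoeff ((P k * Dx k f) $ n) M x \<noteq> 0} \<subseteq> {..mdegree M} \<times> {..mdegree M}"
    by (force simp: not_less[symmetric])
  then show ?thesis by (rule finite_subset) auto
qed


lemma locally_finite_signed_Dx:
  "finite {k. dcoeff (((\<lambda>(s, t). (-1) ^ (s + t) * Dx (s, t) (g (s, t))) k) $ n) M x \<noteq> 0}"
proof -
  have "{k. dcoeff (((\<lambda>(s, t). (-1) ^ (s + t) * Dx (s, t) (g (s, t))) k) $ n) M x \<noteq> 0}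
      \<subseteq> {..mdegree M} \<times> {..mdegree M}"
  proof clarify
    fix s t assume "dcoeff (((-1) ^ (s + t) * Dx (s, t) (g (s, t))) $ n) M x \<noteq> 0"
    then have "dcoeff (Dx (s, t) (g (s, t)) $ n) M x \<noteq> 0"
      by (cases "even (s + t)") auto
    then have "s + t \<le> mdegree M"
      using Dx_low[of M "(s, t)" "g (s, t)" n x] by (cases "s + t \<le> mdegree M") simp_all
    then show "s \<in> {..mdegree M} \<and> t \<in> {..mdegree M}" by simp
  qed
  then show ?thesis by (rule finite_subset) auto
qed

text \<open>The local functional \<open>\<integral>f\<close> as a coset.\<close>

definition loc_fun :: "real set \<Rightarrow> edpoly \<Rightarrow> edpoly set" where
  "loc_fun U f = {g \<in> eps_alg U. \<exists>a\<in>eps_alg U. \<exists>b\<in>eps_alg U.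
     eps_eq U g (f + total_deriv (1, 0) a + total_deriv (0, 1) b)}"

text \<open>The density of \<open>{\<integral>f, \<integral>g}\<close>. The variational derivative annihilates total derivatives, so it
  depends on \<open>f\<close> and \<open>g\<close> only through \<open>\<integral>f\<close> and \<open>\<integral>g\<close>.\<close>

definition bracket :: "diffop \<Rightarrow> edpoly \<Rightarrow> edpoly \<Rightarrow> edpoly" where
  "bracket P f g = var_deriv f * op_apply P (var_deriv g)"

definition is_poisson :: "real set \<Rightarrow> diffop \<Rightarrow> bool" where
  "is_poisson U P \<longleftrightarrow>
     (\<forall>f\<in>eps_alg U. \<forall>g\<in>eps_alg U. loc_fun U (bracket P f g) = loc_fun U (- bracket P g f)) \<and>
     (\<forall>f\<in>eps_alg U. \<forall>g\<in>eps_alg U. \<forall>h\<in>eps_alg U.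
        loc_fun U (bracket P (bracket P f g) h + bracket P (bracket P g h) f
                   + bracket P (bracket P h f) g) = loc_fun U 0)"


section \<open>Miura transformations of the second kind\<close>

definition miura2 :: "real set \<Rightarrow> edpoly \<Rightarrow> bool" where
  "miura2 U v \<longleftrightarrow> v $ 0 = jet (0, 0) \<and> (\<forall>k\<ge>1. v $ k \<in> diffpoly_homog U k)"

text \<open>Substitution of \<open>v\<close> for \<open>u\<close>, that is \<open>\<Sum>\<^sub>M f\<^sub>M(v) \<Prod>\<^bsub>k\<in>M\<^esub> \<partial>\<^sup>k v\<close> with the smooth coefficients
  expanded at \<open>u\<close> by Taylor's formula,
  \<open>f\<^sub>M(v) = \<Sum>\<^sub>j (1/j!) f\<^sub>M\<^sup>(\<^sup>j\<^sup>)(u) (v - u)\<^sup>j\<close>.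
  If \<open>v\<close> is a Miura transformation, \<open>v - u\<close> is divisible by \<open>\<epsilon>\<close>, and at each order of \<open>\<epsilon>\<close> and
  each degree the sum is finite over \<open>U\<close>.\<close>

definition taylor_coeff :: "nat \<Rightarrow> (nat \<times> nat) multiset \<Rightarrow> edpoly \<Rightarrow> edpoly" where
  "taylor_coeff j M f =
     Abs_fps (\<lambda>n. dp_fun (\<lambda>x. (deriv ^^ j) (dcoeff (f $ n) M) x / fact j))"

definition subst_dp :: "edpoly \<Rightarrow> edpoly \<Rightarrow> edpoly" where
  "subst_dp v f = formal_sum (\<lambda>(j, M).
     taylor_coeff j M f * (v - fps_const (jet (0, 0))) ^ j * (\<Prod>k \<in># M. Dx k v))"

text \<open>Both sides are operators acting on expressions in \<open>u\<close>: on the left \<open>L \<circ> P \<circ> L\<^sup>\<dagger>\<close>, on the right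
  \<open>Q\<close>, whose coefficients are given in terms of the new variable, with \<open>v\<close> expressed through \<open>u\<close>.
  A differential operator is determined by its action.\<close>

definition miura_maps :: "real set \<Rightarrow> edpoly \<Rightarrow> diffop \<Rightarrow> diffop \<Rightarrow> bool" where
  "miura_maps U v P Q \<longleftrightarrow>
     (let L = (\<lambda>k. jet_deriv k v) in
      \<forall>f\<in>eps_alg U. eps_eq U (op_apply L (op_apply P (adj_apply L f)))
                              (op_apply (\<lambda>k. subst_dp v (Q k)) f))"


section \<open>Deformations of the bracket and numerical invariants\<close>

text \<open>The operator \<open>\<partial>\<^bsub>x\<^sup>2\<^esub> + \<Sum>\<^bsub>k>0\<^esub> \<epsilon>\<^sup>k \<Sum>\<^bsub>k1+k2\<le>k+1\<^esub> A k k1 k2 \<partial>\<^bsub>x\<^sup>1\<^esub>\<^sup>k\<^sup>1 \<partial>\<^bsub>x\<^sup>2\<^esub>\<^sup>k\<^sup>2\<close>.\<close>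

definition deformed_op :: "(nat \<Rightarrow> nat \<Rightarrow> nat \<Rightarrow> dpoly) \<Rightarrow> diffop" where
  "deformed_op A = (\<lambda>(k1, k2). Abs_fps (\<lambda>k.
     if k = 0 then (if (k1, k2) = (0, 1) then 1 else 0)
     else if k1 + k2 \<le> k + 1 then A k k1 k2 else 0))"

definition homogeneous_coeffs :: "real set \<Rightarrow> (nat \<Rightarrow> nat \<Rightarrow> nat \<Rightarrow> dpoly) \<Rightarrow> bool" where
  "homogeneous_coeffs U A \<longleftrightarrow>
     (\<forall>k>0. \<forall>k1 k2. k1 + k2 \<le> k + 1 \<longrightarrow> A k k1 k2 \<in> diffpoly_homog U (k + 1 - (k1 + k2)))"

text \<open>The value \<open>c 0\<close> is not used: \<open>deformed_op\<close> ignores the coefficients of order \<open>\<epsilon>\<^sup>0\<close>.\<close>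

definition normal_form :: "(nat \<Rightarrow> real) \<Rightarrow> nat \<Rightarrow> nat \<Rightarrow> nat \<Rightarrow> dpoly" where
  "normal_form c k k1 k2 =
     (if even k \<and> k1 = k + 1 \<and> k2 = 0 then dp_const (c (k div 2)) else 0)"

definition numerical_invariants ::
    "real set \<Rightarrow> (nat \<Rightarrow> nat \<Rightarrow> nat \<Rightarrow> dpoly) \<Rightarrow> (nat \<Rightarrow> real) \<Rightarrow> bool" where
  "numerical_invariants U A c \<longleftrightarrow>
     (\<exists>v. miura2 U v \<and> miura_maps U v (deformed_op A) (deformed_op (normal_form c)))"

end

theory Submission
  imports Defs
begin

text \<open>Modulo coefficients of positive differential degree, differential operators commute with
  functions of \<open>u\<close>, so passing to principal symbols turns \<open>L \<circ> P \<circ> L\<^sup>\<dagger> = Q\<close> into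
  \<open>g(\<xi>) p(\<xi>) = \<xi>\<^sub>2 + \<Sum>\<^sub>k c\<^sub>k \<epsilon>\<^sup>2\<^sup>k \<xi>\<^sub>1\<^sup>2\<^sup>k\<^sup>+\<^sup>1\<close> with \<open>g(\<xi>) = l(\<xi>) l(-\<xi>)\<close>. The coefficients of \<open>\<epsilon>\<^sup>2 \<xi>\<^sub>1\<^sup>3\<close>,
  \<open>\<epsilon>\<^sup>4 \<xi>\<^sub>1\<^sup>5\<close> and \<open>\<epsilon>\<^sup>2 \<xi>\<^sub>1\<^sup>2 \<xi>\<^sub>2\<close> give \<open>A\<^sub>2\<^sub>;\<^sub>3\<^sub>,\<^sub>0 = c\<^sub>1\<close>, \<open>A\<^sub>4\<^sub>;\<^sub>5\<^sub>,\<^sub>0 + g\<^sub>2 c\<^sub>1 = c\<^sub>2\<close> and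
  \<open>A\<^sub>2\<^sub>;\<^sub>2\<^sub>,\<^sub>1 + g\<^sub>2 = 0\<close>, where \<open>g\<^sub>2\<close> is the coefficient of \<open>\<epsilon>\<^sup>2 \<xi>\<^sub>1\<^sup>2\<close> in \<open>g\<close>. To read off symbols, the
  operators are applied to \<open>u\<^sup>(\<^sup>1\<^sup>,\<^sup>0\<^sup>)\<close> and the part of the result linear in the jet variables is
  taken.\<close>

section \<open>Low-order coefficients and symbols\<close>

lemma dcoeff_mult_empty: "dcoeff (f * g) {#} x = dcoeff f {#} x * dcoeff g {#} x"
proof -
  have "{(N, K). N + K = {#}} = {({#}, {#} :: (nat \<times> nat) multiset)}" by auto
  then show ?thesis by (simp add: dcoeff_mult)
qed

lemma dcoeff_mult_single:
  "dcoeff (f * g) {#m#} x = dcoeff f {#} x * dcoeff g {#m#} x + dcoeff f {#m#} x * dcoeff g {#} x"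
proof -
  have "{(N, K). N + K = {#m#}} = {({#}, {#m#}), ({#m#}, {#})}"
    by (auto simp: union_is_single)
  then show ?thesis by (simp add: dcoeff_mult)
qed

lemma dcoeff_sum: "dcoeff (sum g I) M x = (\<Sum>i\<in>I. dcoeff (g i) M x)"
  by (induction I rule: infinite_finite_induct) auto

lemma dcoeff_formal_sum:
  "dcoeff (formal_sum g $ n) M x = Sum_any (\<lambda>i. dcoeff (g i $ n) M x)"
  by (simp add: formal_sum_def)

text \<open>The outermost power series variable is \<open>\<xi>\<^sub>2\<close>, followed by \<open>\<xi>\<^sub>1\<close> and \<open>\<epsilon>\<close>.\<close>

definition linear_part :: "real \<Rightarrow> edpoly \<Rightarrow> real fps fps fps" where
  "linear_part x f = Abs_fps (\<lambda>b. Abs_fps (\<lambda>a. Abs_fps (\<lambda>n. dcoeff (f $ n) {#(a, b)#} x)))"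

definition zero_part :: "real \<Rightarrow> edpoly \<Rightarrow> real fps" where
  "zero_part x f = Abs_fps (\<lambda>n. dcoeff (f $ n) {#} x)"

definition symbol :: "real \<Rightarrow> diffop \<Rightarrow> real fps fps fps" where
  "symbol x P = Abs_fps (\<lambda>b. Abs_fps (\<lambda>a. zero_part x (P (a, b))))"

text \<open>The symbol of the formal adjoint, that is \<open>symbol x P\<close> at -\<xi>: each
  derivative moved across contributes a sign.\<close>

definition adj_symbol :: "real \<Rightarrow> diffop \<Rightarrow> real fps fps fps" where
  "adj_symbol x P = Abs_fps (\<lambda>b. Abs_fps (\<lambda>a. (-1) ^ (a + b) * zero_part x (P (a, b))))"

text \<open>The condition at \<open>(0, 0)\<close> lets total derivatives act on linear coefficients
  as a pure index shift, with no exception at the lowest index.\<close>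

definition no_zero_part :: "real set \<Rightarrow> edpoly \<Rightarrow> bool" where
  "no_zero_part U f \<longleftrightarrow>
     (\<forall>n. \<forall>x\<in>U. dcoeff (f $ n) {#} x = 0 \<and> dcoeff (f $ n) {#(0, 0)#} x = 0)"

section \<open>Total derivatives and products on linear parts\<close>

lemma deriv_eq_0_on_open:
  assumes "open U" "x \<in> U" "\<And>y. y \<in> U \<Longrightarrow> f y = (0 :: real)"
  shows "deriv f x = 0"
proof -
  have "((\<lambda>_. 0) has_real_derivative 0) (at x)" by simp
  then have "(f has_real_derivative 0) (at x)"
    by (rule has_field_derivative_transform_within_open[OF _ assms(1,2)]) (simp add: assms(3))
  then show ?thesis by (rule DERIV_imp_deriv)
qed

lemma dcoeff_total_deriv_empty:
  "e \<noteq> (0, 0) \<Longrightarrow> dcoeff (total_deriv e f $ n) {#} x = 0"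
  by (simp add: dcoeff_total_deriv)

text \<open>A linear monomial arises only from the one with shifted index. If that index is
  \<open>(0, 0)\<close>, it arises instead from the u-derivative of the \<open>{#}\<close>
  coefficient, which vanishes near x because U is open.\<close>

lemma dcoeff_total_deriv_single:
  assumes "open U" "x \<in> U" "no_zero_part U f" "(c, d) \<noteq> (0, 0)"
  shows "dcoeff (total_deriv (c, d) f $ n) {#(a, b)#} x =
    (if c \<le> a \<and> d \<le> b then dcoeff (f $ n) {#(a - c, b - d)#} x else 0)"
proof (cases "c \<le> a \<and> d \<le> b")
  case True
  then have "{k. k + (c, d) \<in># {#(a, b)#}} = {(a - c, b - d)}" by auto
  then have "dcoeff (total_deriv (c, d) f $ n) {#(a, b)#} x =
      dcoeff (jet_deriv (a - c, b - d) f $ n) {#} x"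
    using True by (simp add: dcoeff_total_deriv[OF assms(4)])
  also have "\<dots> = dcoeff (f $ n) {#(a - c, b - d)#} x"
    using assms(1-3) deriv_eq_0_on_open[of U x "dcoeff (f $ n) {#}"]
    by (auto simp: jet_deriv_def no_zero_part_def)
  finally show ?thesis using True by simp
next
  case False
  then have "{k. k + (c, d) \<in># {#(a, b)#}} = {}" by auto
  then show ?thesis by (simp only: dcoeff_total_deriv[OF assms(4)] sum.empty False if_False)
qed

lemma no_zero_part_total_deriv:
  assumes "open U" "no_zero_part U f" "e \<noteq> (0, 0)"
  shows "no_zero_part U (total_deriv e f)"
  using assms by (cases e) (auto simp: no_zero_part_def dcoeff_total_deriv_empty
      dcoeff_total_deriv_single[of U _ f])

lemma linear_part_total_deriv:
  assumes "open U" "x \<in> U" "no_zero_part U f"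
  shows "linear_part x (total_deriv (1, 0) f) = fps_const fps_X * linear_part x f"
    and "linear_part x (total_deriv (0, 1) f) = fps_X * linear_part x f"
  by (auto simp: fps_eq_iff linear_part_def dcoeff_total_deriv_single[OF assms])

lemma Dx_linear:
  assumes "open U" "no_zero_part U f"
  shows no_zero_part_Dx: "no_zero_part U (Dx (s, t) f)"
    and linear_part_Dx: "x \<in> U \<Longrightarrow>
      linear_part x (Dx (s, t) f) = fps_const fps_X ^ s * (fps_X ^ t * linear_part x f)"
proof -
  let ?g = "\<lambda>t. (total_deriv (0, 1) ^^ t) f"
  let ?h = "\<lambda>s. (total_deriv (1, 0) ^^ s) (?g t)"
  have g: "no_zero_part U (?g t) \<and>
      (x \<in> U \<longrightarrow> linear_part x (?g t) = fps_X ^ t * linear_part x f)" for t x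
    by (induction t)
      (use assms in \<open>auto simp: no_zero_part_total_deriv linear_part_total_deriv[of U] mult.assoc
        simp del: One_nat_def\<close>)
  have h: "no_zero_part U (?h s) \<and>
      (x \<in> U \<longrightarrow> linear_part x (?h s) = fps_const fps_X ^ s * (fps_X ^ t * linear_part x f))" for s x
    by (induction s)
      (use assms g in \<open>auto simp: no_zero_part_total_deriv linear_part_total_deriv[of U] mult.assoc
        simp del: One_nat_def\<close>)
  show "no_zero_part U (Dx (s, t) f)" using h by (simp add: Dx_def)
  show "x \<in> U \<Longrightarrow>
      linear_part x (Dx (s, t) f) = fps_const fps_X ^ s * (fps_X ^ t * linear_part x f)"
    using h by (simp add: Dx_def)
qed

lemma no_zero_part_mult: "no_zero_part U f \<Longrightarrow> no_zero_part U (g * f)"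
  by (simp add: no_zero_part_def fps_mult_nth dcoeff_sum dcoeff_mult_empty dcoeff_mult_single)

lemma linear_part_mult:
  assumes "x \<in> U" "no_zero_part U f"
  shows "linear_part x (g * f) = fps_const (fps_const (zero_part x g)) * linear_part x f"
proof -
  have "linear_part x (g * f) $ b $ a = zero_part x g * linear_part x f $ b $ a" for a b
    using assms
    by (simp add: fps_eq_iff linear_part_def zero_part_def fps_mult_nth dcoeff_sum
        dcoeff_mult_single no_zero_part_def)
  then show ?thesis by (intro fps_ext) simp
qed

lemma fps_const_power_mult_nth:
  "(fps_const c ^ s * F) $ b = c ^ s * (F :: 'a :: comm_ring_1 fps) $ b"
  by (simp add: fps_const_power)

lemma linear_part_mult_Dx:
  assumes "open U" "x \<in> U" "no_zero_part U f"
  shows "linear_part x (g * Dx (s, t) f) $ b $ a =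
    (if s \<le> a \<and> t \<le> b then zero_part x g * linear_part x f $ (b - t) $ (a - s) else 0)"
  using assms
  by (simp add: linear_part_mult[OF assms(2) no_zero_part_Dx] linear_part_Dx[of U]
      fps_const_power_mult_nth fps_X_power_mult_nth del: fps_const_power)

text \<open>The right-hand side agrees with that of \<open>linear_part_mult_Dx\<close>: derivatives
  falling on g only give terms at least quadratic in the jet variables. This is the commutation of
  operators with functions of u.\<close>

lemma linear_part_Dx_mult:
  assumes "open U" "x \<in> U" "no_zero_part U f"
  shows "linear_part x (Dx (s, t) (g * f)) $ b $ a =
    (if s \<le> a \<and> t \<le> b then zero_part x g * linear_part x f $ (b - t) $ (a - s) else 0)"
  using assms
  by (simp add: linear_part_mult[OF assms(2)] linear_part_Dx[OF assms(1) no_zero_part_mult]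
      fps_const_power_mult_nth fps_X_power_mult_nth del: fps_const_power)

section \<open>Operators acting on linear parts\<close>

text \<open>The hypothesis describes the terms of a Cauchy product in \<open>\<xi>\<^sub>1\<close>
  and \<open>\<xi>\<^sub>2\<close>; only the finitely many pairs below \<open>(a, b)\<close>
  contribute to a given coefficient.\<close>

lemma linear_part_formal_sum:
  assumes "\<And>s t a b. linear_part x (h (s, t)) $ b $ a =
      (if s \<le> a \<and> t \<le> b then S $ t $ s * F $ (b - t) $ (a - s) else 0)"
  shows "linear_part x (formal_sum h) = S * F"
proof -
  have "linear_part x (formal_sum h) $ b $ a $ n = (S * F) $ b $ a $ n" for a b n
  proof -
    let ?d = "\<lambda>k. dcoeff (h k $ n) {#(a, b)#} x"
    have d: "?d (s, t) = (if s \<le> a \<and> t \<le> b then (S $ t $ s * F $ (b - t) $ (a - s)) $ n else 0)"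
      for s t
      using arg_cong[OF assms[of s t b a], of "\<lambda>f. f $ n"]
      by (simp add: linear_part_def split: if_splits)
    have "linear_part x (formal_sum h) $ b $ a $ n = Sum_any ?d"
      by (simp add: linear_part_def dcoeff_formal_sum)
    also have "\<dots> = sum ?d ({..a} \<times> {..b})"
      by (rule Sum_any.expand_superset) (auto simp: d split: if_splits)
    also have "\<dots> = (\<Sum>s\<le>a. \<Sum>t\<le>b. (S $ t $ s * F $ (b - t) $ (a - s)) $ n)"
      by (subst sum.cartesian_product) (auto simp: d intro!: sum.cong)
    also have "\<dots> = (\<Sum>t\<le>b. \<Sum>s\<le>a. (S $ t $ s * F $ (b - t) $ (a - s)) $ n)"
      by (rule sum.swap)
    also have "\<dots> = (S * F) $ b $ a $ n"
      by (simp add: fps_mult_nth[of S] fps_mult_nth[of "S $ _"] fps_sum_nth atLeast0AtMost)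
    finally show ?thesis .
  qed
  then show ?thesis by (simp add: fps_eq_iff)
qed

lemma no_zero_part_formal_sum:
  "(\<And>k. no_zero_part U (h k)) \<Longrightarrow> no_zero_part U (formal_sum h)"
  by (simp add: no_zero_part_def dcoeff_formal_sum)

text \<open>Since \<open>no_zero_part\<close> is preserved, the multiplication rule can be iterated
  along a composition of operators.\<close>

lemma op_apply_linear:
  assumes "open U" "no_zero_part U f"
  shows no_zero_part_op_apply: "no_zero_part U (op_apply P f)"
    and linear_part_op_apply:
      "x \<in> U \<Longrightarrow> linear_part x (op_apply P f) = symbol x P * linear_part x f"
proof -
  show "no_zero_part U (op_apply P f)"
    unfolding op_apply_def
    by (rule no_zero_part_formal_sum) (use assms in \<open>auto simp: no_zero_part_mult no_zero_part_Dx\<close>)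
  show "x \<in> U \<Longrightarrow> linear_part x (op_apply P f) = symbol x P * linear_part x f"
    unfolding op_apply_def
    by (rule linear_part_formal_sum) (use assms in \<open>simp add: linear_part_mult_Dx[of U] symbol_def\<close>)
qed

lemma adj_apply_linear:
  assumes "open U" "no_zero_part U f"
  shows no_zero_part_adj_apply: "no_zero_part U (adj_apply P f)"
    and linear_part_adj_apply:
      "x \<in> U \<Longrightarrow> linear_part x (adj_apply P f) = adj_symbol x P * linear_part x f"
proof -
  show "no_zero_part U (adj_apply P f)"
    unfolding adj_apply_def
    by (rule no_zero_part_formal_sum)
      (use assms in \<open>auto intro!: no_zero_part_mult no_zero_part_Dx\<close>)
  have sign: "linear_part x ((-1) ^ k * g) $ b $ a = (-1) ^ k * linear_part x g $ b $ a" for k g a b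
    by (cases "even k") (simp_all add: fps_eq_iff linear_part_def)
  show "x \<in> U \<Longrightarrow> linear_part x (adj_apply P f) = adj_symbol x P * linear_part x f"
    unfolding adj_apply_def
    by (rule linear_part_formal_sum)
      (use assms in \<open>simp add: sign linear_part_Dx_mult[of U] adj_symbol_def mult.assoc\<close>)
qed

section \<open>The symbol identity of a Miura transformation\<close>

text \<open>Constant coefficients leave only the Taylor term with j = 0 and M = \<open>{#}\<close>.
  Hence the normal form reads the same in u and in v.\<close>

lemma subst_dp_constant:
  assumes "\<And>n. f $ n = dp_const (a n)"
  shows "subst_dp v f = f"
proof -
  let ?h = "\<lambda>(j, M). taylor_coeff j M f * (v - fps_const (jet (0, 0))) ^ j * (\<Prod>k \<in># M. Dx k v)"
  have f: "dcoeff (f $ n) M = (\<lambda>_. if M = {#} then a n else 0)" for n M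
    by (auto simp: assms dp_const_def dp_fun_def)
  have d: "(deriv ^^ j) (\<lambda>_. r :: real) = (\<lambda>_. if j = 0 then r else 0)" for j r
    by (induction j) auto
  have t: "taylor_coeff j M f = (if (j, M) = (0, {#}) then f else 0)" for j M
    by (auto simp: fps_eq_iff taylor_coeff_def f d dp_fun_def intro!: dpoly_eqI)
  have "dcoeff (subst_dp v f $ n) M x = dcoeff (f $ n) M x" for n M x
  proof -
    have "dcoeff (subst_dp v f $ n) M x = Sum_any (\<lambda>i. dcoeff (?h i $ n) M x)"
      unfolding subst_dp_def dcoeff_formal_sum ..
    also have "\<dots> = (\<Sum>i\<in>{(0, {#})}. dcoeff (?h i $ n) M x)"
      by (rule Sum_any.expand_superset) (auto simp: t split: if_splits)
    finally show ?thesis by (simp add: t)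
  qed
  then show ?thesis by (auto simp: fps_eq_iff intro: dpoly_eqI)
qed

lemma subst_dp_normal_form:
  "subst_dp v (deformed_op (normal_form c) k) = deformed_op (normal_form c) k"
proof (cases k)
  case (Pair k1 k2)
  have z: "dp_const 0 = 0" and o: "dp_const 1 = 1"
    by (auto intro!: dpoly_eqI simp: dp_const_def dp_fun_def dcoeff_1)
  let ?a = "\<lambda>n. if n = 0 then if (k1, k2) = (0, 1) then 1 else 0
      else if even n \<and> k1 = n + 1 \<and> k2 = 0 then c (n div 2) else 0"
  show ?thesis
    unfolding Pair by (rule subst_dp_constant[where a = ?a])
      (auto simp: deformed_op_def normal_form_def z o)
qed

lemma jet_in_diffpoly_alg: "k \<noteq> (0, 0) \<Longrightarrow> jet k \<in> diffpoly_alg U"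
proof -
  have "(deriv ^^ j) (\<lambda>_. r :: real) = (\<lambda>_. if j = 0 then r else 0)" for j r
    by (induction j) auto
  then show "k \<noteq> (0, 0) \<Longrightarrow> jet k \<in> diffpoly_alg U"
    by (auto simp: diffpoly_alg_def jet_def smooth_fun_on_def)
qed

lemma zero_in_diffpoly_alg: "0 \<in> diffpoly_alg U"
proof -
  have "(deriv ^^ j) (\<lambda>_. 0 :: real) = (\<lambda>_. 0)" for j
    by (induction j) auto
  moreover have "dcoeff 0 M = (\<lambda>_. 0)" for M by auto
  ultimately show ?thesis by (simp add: diffpoly_alg_def smooth_fun_on_def)
qed

lemma symbol_miura:
  assumes "open U" "x \<in> U" "miura_maps U v P Q" "\<And>k. subst_dp v (Q k) = Q k"
  defines "L \<equiv> \<lambda>k. jet_deriv k v"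
  shows "symbol x L * adj_symbol x L * symbol x P = symbol x Q"
proof -
  \<comment> \<open>The variable u itself would violate \<open>no_zero_part\<close>, its
    \<open>{#}\<close> coefficient being u. The linear part of this choice is
    \<open>\<xi>\<^sub>1\<close>.\<close>
  define f where "f = fps_const (jet (1, 0))"
  have f: "f \<in> eps_alg U"
    by (auto simp: f_def eps_alg_def jet_in_diffpoly_alg zero_in_diffpoly_alg)
  have nz: "no_zero_part U f"
    by (auto simp: f_def no_zero_part_def jet_def)
  have "linear_part x f $ 0 $ 1 $ 0 = 1"
    by (simp add: linear_part_def f_def jet_def)
  then have ne: "linear_part x f \<noteq> 0" by auto
  have "eps_eq U (op_apply L (op_apply P (adj_apply L f))) (op_apply Q f)"
    using assms(3) f by (simp add: miura_maps_def assms(4) L_def Let_def)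
  then have "linear_part x (op_apply L (op_apply P (adj_apply L f))) = linear_part x (op_apply Q f)"
    using assms(2) by (simp add: fps_eq_iff eps_eq_def dp_eq_def linear_part_def)
  then have "symbol x L * (symbol x P * (adj_symbol x L * linear_part x f)) =
      symbol x Q * linear_part x f"
    using assms(1,2) nz
    by (simp add: linear_part_op_apply[of U] linear_part_adj_apply[of U] no_zero_part_op_apply
        no_zero_part_adj_apply)
  then have "(symbol x L * adj_symbol x L * symbol x P) * linear_part x f =
      symbol x Q * linear_part x f"
    by (simp add: mult_ac)
  \<comment> \<open>Iterated power series over the reals form an integral domain, so the nonzero
    factor cancels.\<close>
  then show ?thesis using ne by simp
qed

section \<open>Homogeneity of the symbols\<close>

text \<open>Differentiating the degree n component of v by
  \<open>u\<^sup>(\<^sup>a\<^sup>,\<^sup>b\<^sup>)\<close> lowers the degree by a + b, so a function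
  of u alone can survive only when a + b = n.\<close>

lemma zero_part_jet_deriv_miura:
  assumes "open U" "x \<in> U" "miura2 U v"
  shows "a + b \<noteq> n \<Longrightarrow> zero_part x (jet_deriv (a, b) v) $ n = 0"
    and "zero_part x (jet_deriv (0, 0) v) $ 0 = 1"
proof -
  have v0: "v $ 0 = jet (0, 0)"
    and v: "\<And>n M y. n > 0 \<Longrightarrow> mdegree M \<noteq> n \<Longrightarrow> y \<in> U \<Longrightarrow> dcoeff (v $ n) M y = 0"
    using assms(3) by (auto simp: miura2_def diffpoly_homog_def)
  show "zero_part x (jet_deriv (0, 0) v) $ 0 = 1"
    by (simp add: zero_part_def jet_deriv_def v0 jet_def dp_fun_def)
  show "zero_part x (jet_deriv (a, b) v) $ n = 0" if "a + b \<noteq> n"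
  proof (cases "n = 0")
    case True
    then show ?thesis using that
      by (auto simp: zero_part_def jet_deriv_def v0 jet_def dp_fun_def)
  next
    case False
    then show ?thesis using that assms(1,2) v
      by (auto simp: zero_part_def jet_deriv_def mdegree_def intro!: deriv_eq_0_on_open[of U x])
  qed
qed

text \<open>Below top order the coefficients have positive degree and thus no part depending on u
  alone.\<close>

lemma symbol_deformed_op:
  assumes "homogeneous_coeffs U A" "x \<in> U"
  shows "symbol x (deformed_op A) $ b $ a $ n =
    (if n = 0 then if (a, b) = (0, 1) then 1 else 0
     else if a + b = n + 1 then dcoeff (A n a b) {#} x else 0)"
proof -
  have "dcoeff (A n a b) {#} x = 0" if "n > 0" "a + b < n + 1"
  proof -
    have "A n a b \<in> diffpoly_homog U (n + 1 - (a + b))"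
      using assms(1) that by (simp add: homogeneous_coeffs_def)
    then show ?thesis using that assms(2) by (simp add: diffpoly_homog_def mdegree_def)
  qed
  then show ?thesis
    by (auto simp: symbol_def zero_part_def deformed_op_def dcoeff_1)
qed

lemma homogeneous_coeffs_normal_form: "homogeneous_coeffs U (normal_form c)"
proof -
  have d: "(deriv ^^ j) (\<lambda>_. r :: real) = (\<lambda>_. if j = 0 then r else 0)" for j r
    by (induction j) auto
  have "dcoeff (dp_const r) M = (\<lambda>_. if M = {#} then r else 0)" for r M
    by (auto simp: dp_const_def dp_fun_def)
  then have "dp_const r \<in> diffpoly_homog U 0" for r
    by (auto simp: diffpoly_homog_def diffpoly_alg_def smooth_fun_on_def d mdegree_def)
  then show ?thesis
    by (auto simp: homogeneous_coeffs_def normal_form_def diffpoly_homog_def zero_in_diffpoly_alg)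
qed

text \<open>A nonempty monomial of degree zero contains the index \<open>(0, 0)\<close>, which the
  carrier excludes.\<close>

lemma dcoeff_homog_0:
  assumes "f \<in> diffpoly_homog U 0" "x \<in> U" "M \<noteq> {#}"
  shows "dcoeff f M x = 0"
proof (cases "mdegree M = 0")
  case True
  obtain s t where "(s, t) \<in># M" using assms(3) by fastforce
  moreover have "s + t = 0" using True \<open>(s, t) \<in># M\<close> by (auto simp: mdegree_def)
  ultimately show ?thesis using assms by (auto simp: diffpoly_homog_def diffpoly_alg_def)
qed (use assms in \<open>auto simp: diffpoly_homog_def\<close>)

section \<open>Comparison of symbol coefficients\<close>

text \<open>Working at one point is enough: c does not depend on x, so the first identity also
  yields the constancy of \<open>A 2 3 0\<close>.\<close>

lemma invariants_pointwise:
  assumes U: "open U" "x \<in> U"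
    and A: "homogeneous_coeffs U A"
    and c: "numerical_invariants U A c"
  shows "dcoeff (A 2 3 0) {#} x = c 1"
    and "c 2 = dcoeff (A 4 5 0) {#} x - dcoeff (A 2 3 0) {#} x * dcoeff (A 2 2 1) {#} x"
proof -
  obtain v where v: "miura2 U v" "miura_maps U v (deformed_op A) (deformed_op (normal_form c))"
    using c by (auto simp: numerical_invariants_def)
  define L where "L = symbol x (\<lambda>k. jet_deriv k v)"
  define L' where "L' = adj_symbol x (\<lambda>k. jet_deriv k v)"
  define G where "G = L * L'"
  define P where "P = symbol x (deformed_op A)"
  define Q where "Q = symbol x (deformed_op (normal_form c))"
  have GP: "G * P = Q"
    unfolding G_def P_def Q_def L_def L'_def by (rule symbol_miura[OF U v(2) subst_dp_normal_form])
  have L: "L $ b $ a $ n = 0" if "n \<noteq> a + b" for a b n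
    using that zero_part_jet_deriv_miura[OF U v(1)] by (simp add: L_def symbol_def)
  have L': "L' $ b $ a $ n = (-1) ^ (a + b) * L $ b $ a $ n" for a b n
    by (cases "even (a + b)") (simp_all add: L_def L'_def symbol_def adj_symbol_def)
  have L0: "L $ 0 $ 0 $ 0 = 1"
    using zero_part_jet_deriv_miura[OF U v(1)] by (simp add: L_def symbol_def)
  \<comment> \<open>If both factors of a term had matching degrees, these would add up to n = a +
    b.\<close>
  have G: "G $ b $ a $ n = 0" if "n \<noteq> a + b" for a b n
  proof -
    have "L $ i $ j $ k * L' $ (b - i) $ (a - j) $ (n - k) = 0"
      if "i \<le> b" "j \<le> a" "k \<le> n" for i j k
    proof -
      have "k \<noteq> j + i \<or> n - k \<noteq> (a - j) + (b - i)"
        using that \<open>n \<noteq> a + b\<close> by linarith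
      then show ?thesis using L[of k j i] L[of "n - k" "a - j" "b - i"] by (auto simp: L')
    qed
    then show ?thesis
      unfolding G_def fps_mult_nth fps_sum_nth by (intro sum.neutral ballI) simp
  qed
  \<comment> \<open>The linear coefficient cancels because l(\<xi>) l(-\<xi>) is even.\<close>
  have G0: "G $ 0 $ 0 $ 0 = 1" and G1: "G $ 0 $ Suc 0 $ Suc 0 = 0"
    by (simp_all add: G_def fps_mult_nth fps_sum_nth L L0 L')
  note P = symbol_deformed_op[OF A U(2), folded P_def]
  note Q = symbol_deformed_op[OF homogeneous_coeffs_normal_form U(2), of c, folded Q_def]
  have Pz: "P $ b $ a $ n = 0" if "a + b \<noteq> n + 1" for a b n
    using that by (auto simp: P)
  have P0: "P $ 0 $ Suc 0 $ 0 = 0" "P $ Suc 0 $ 0 $ 0 = 1"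
    by (simp_all add: P)
  \<comment> \<open>The two gradings fix the \<epsilon>-exponent of each factor, so the triple
    convolutions shrink to short sums over the \<xi>-exponents.\<close>
  note ex = fps_mult_nth fps_sum_nth numeral_eq_Suc G G0 G1 Pz P0
  have 1: "(G * P) $ 0 $ 2 $ 1 = P $ 0 $ 2 $ 1"
    by (simp add: ex)
  have 2: "(G * P) $ 0 $ 3 $ 2 = P $ 0 $ 3 $ 2"
    by (simp add: ex)
  have 4: "(G * P) $ 0 $ 5 $ 4 =
      P $ 0 $ 5 $ 4 + G $ 0 $ 2 $ 2 * P $ 0 $ 3 $ 2 + G $ 0 $ 3 $ 3 * P $ 0 $ 2 $ 1"
    by (simp add: ex)
  have 5: "(G * P) $ 1 $ 2 $ 2 = P $ 1 $ 2 $ 2 + G $ 0 $ 2 $ 2 + G $ 1 $ 0 $ 1 * P $ 0 $ 2 $ 1"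
    by (simp add: ex)
  have c1: "dcoeff (dp_const r) {#} x = r" for r
    by (simp add: dp_const_def dp_fun_def)
  \<comment> \<open>The normal form has no term of order \<epsilon>. The vanishing of this
    coefficient removes the remaining unknown coefficients of \<open>G\<close> from \<open>4\<close>
    and \<open>5\<close>.\<close>
  have "P $ 0 $ 2 $ 1 = 0" using 1 by (simp add: GP Q normal_form_def)
  moreover have "P $ 0 $ 3 $ 2 = c 1" using 2 by (simp add: GP Q normal_form_def c1)
  moreover have "(G * P) $ 0 $ 5 $ 4 = c 2" by (simp add: GP Q normal_form_def c1)
  moreover have "(G * P) $ 1 $ 2 $ 2 = 0" by (simp add: GP Q normal_form_def)
  moreover have "P $ 0 $ 3 $ 2 = dcoeff (A 2 3 0) {#} x" "P $ 0 $ 5 $ 4 = dcoeff (A 4 5 0) {#} x"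
    "P $ 1 $ 2 $ 2 = dcoeff (A 2 2 1) {#} x"
    by (simp_all add: P)
  ultimately have *: "dcoeff (A 2 3 0) {#} x = c 1"
      "dcoeff (A 4 5 0) {#} x + G $ 0 $ 2 $ 2 * c 1 = c 2"
      "G $ 0 $ 2 $ 2 = - dcoeff (A 2 2 1) {#} x"
    using 4 5 by simp_all
  show "dcoeff (A 2 3 0) {#} x = c 1" by (rule *)
  show "c 2 = dcoeff (A 4 5 0) {#} x - dcoeff (A 2 3 0) {#} x * dcoeff (A 2 2 1) {#} x"
    using *(2) unfolding *(1,3) by (simp add: mult.commute)
qed

theorem proposition12:
  fixes U :: "real set"
    and A :: "nat \<Rightarrow> nat \<Rightarrow> nat \<Rightarrow> dpoly"
    and c :: "nat \<Rightarrow> real"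
  assumes "open U" "is_interval U" "U \<noteq> {}"
    and "homogeneous_coeffs U A"
    and "is_poisson U (deformed_op A)"
    and "numerical_invariants U A c"
  shows "(\<exists>a. dp_eq U (A 2 3 0) (dp_const a)) \<and>
         dp_eq U (dp_const (c 1)) (A 2 3 0) \<and>
         dp_eq U (dp_const (c 2)) (A 4 5 0 - A 2 3 0 * A 2 2 1)"
proof -
  have A: "A 2 3 0 \<in> diffpoly_homog U 0" "A 2 2 1 \<in> diffpoly_homog U 0"
    "A 4 5 0 \<in> diffpoly_homog U 0"
    using assms(4)[unfolded homogeneous_coeffs_def, rule_format, of 2 3 0]
      assms(4)[unfolded homogeneous_coeffs_def, rule_format, of 2 2 1]
      assms(4)[unfolded homogeneous_coeffs_def, rule_format, of 4 5 0] by simp_all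
  note inv = invariants_pointwise[OF assms(1) _ assms(4,6)]
  have const: "dcoeff (dp_const r) M x = (if M = {#} then r else 0)" for r M x
    by (simp add: dp_const_def dp_fun_def)
  \<comment> \<open>\<open>dp_eq\<close> compares all monomials: the pointwise identities settle
    \<open>{#}\<close>, and degree zero settles the others.\<close>
  have 1: "dcoeff (A 2 3 0) M x = dcoeff (dp_const (c 1)) M x" if "x \<in> U" for M x
    using inv(1)[OF that] dcoeff_homog_0[OF A(1) that] by (simp add: const)
  have prod: "dcoeff (A 2 3 0 * A 2 2 1) M x = 0" if "x \<in> U" "M \<noteq> {#}" for M x
    unfolding dcoeff_mult
  proof (intro sum.neutral ballI, clarify)
    fix N K assume "M = N + K"
    then have "N \<noteq> {#} \<or> K \<noteq> {#}" using that(2) by auto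
    then show "dcoeff (A 2 3 0) N x * dcoeff (A 2 2 1) K x = 0"
      using dcoeff_homog_0[OF A(1) that(1)] dcoeff_homog_0[OF A(2) that(1)] by auto
  qed
  have 2: "dcoeff (dp_const (c 2)) M x = dcoeff (A 4 5 0 - A 2 3 0 * A 2 2 1) M x"
    if "x \<in> U" for M x
    using inv(2)[OF that] prod[OF that] dcoeff_homog_0[OF A(3) that]
    by (cases "M = {#}") (simp_all add: const dcoeff_mult_empty)
  show ?thesis using 1 2 by (auto simp: dp_eq_def)
qed

end
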